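(* Let $n\ge1$, let $(u,v,w)\in\mathbb{R}^3$ be a vector whose Euclidean norm is $j:=n/2$, and let $f:S^2\to\mathbb{R}$ be the Kähler function defined by $f(x,y,z):=ux+vy+wz$, where $S^2$ is the unit sphere in $\mathbb{R}^3$. Then $$\mathrm{spec}(f)=\{-j,-j+1,\dots,j-1,j\},$$ and for all $(x,y,z)\in S^2$ and $k\in\{0,\dots,n\}$, $$P_{f,(x,y,z)}(-j+k)=\binom nk\big(\cos^2(\theta/2)\big)^k\big(\sin^2(\theta/2)\big)^{n-k},$$ where $\theta$ is an angle satisfying $\frac{ux+vy+wz}{\|(u,v,w)\|}=\cos(\theta)$.
   Context: Let $\Omega=\{0,\dots,n\}$ with counting measure. The map $\pi_{\overline{\mathcal{B}}(n,q)}$ sends $(x,y,z)\in S^2$ to the probability on $\Omega$ given by $\pi_{\overline{\mathcal{B}}(n,q)}(x,y,z)(k)=\frac1{2^n}\binom nk(1+x)^k(1-x)^{n-k}$ (with $0^0=1$). $\mathcal{A}_{\mathcal{B}(n,q)}$ is the space of functions $X:\Omega\to\mathbb{R}$ of the form $X(k)=\alpha+\beta k$, $\alpha,\beta\in\mathbb{R}$. The Kähler functions on $S^2$ are exactly the linear combinations of $1,x,y,z$, and each of them can be written as $$f(x,y,z)=\sum_{k=0}^nX(k)\,\big[(\pi_{\overline{\mathcal{B}}(n,q)}\circ\phi)(x,y,z)\big](k),\qquad (x,y,z)\in S^2,$$ with $X\in\mathcal{A}_{\mathcal{B}(n,q)}$ and $\phi\in SO(3)$. For such a decomposition, $\mathrm{spec}(f):=\mathrm{Im}(X)$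 and, for $A\subseteq\mathrm{spec}(f)$, $P_{f,(x,y,z)}(A):=\sum_{k\in X^{-1}(A)}\big[(\pi_{\overline{\mathcal{B}}(n,q)}\circ\phi)(x,y,z)\big](k)$; these do not depend on the decomposition chosen. $P_{f,(x,y,z)}(\lambda)$ means $P_{f,(x,y,z)}(\{\lambda\})$. *)

theory Defs
  imports "HOL-Analysis.Analysis"
begin

text \<open>
  Points of \<open>S\<^sup>2\<close> are the elements \<open>vector [x, y, z]\<close> of \<^term>\<open>sphere 0 1 :: (real^3) set\<close>.
  A function on \<open>S\<^sup>2\<close> (on \<open>\<Omega> = {0..n}\<close>) is a total function on \<^typ>\<open>real^3\<close> (on \<^typ>\<open>nat\<close>)
  of which only the values on \<open>S\<^sup>2\<close> (on \<open>\<Omega>\<close>) are ever used.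
\<close>

definition binomial_prob :: "nat \<Rightarrow> real^3 \<Rightarrow> nat \<Rightarrow> real"
  where "binomial_prob n s k =
    1 / 2 ^ n * real (n choose k) * (1 + s $ 1) ^ k * (1 - s $ 1) ^ (n - k)"

definition affine_rvs :: "nat \<Rightarrow> (nat \<Rightarrow> real) set"
  where "affine_rvs n = {X. \<exists>\<alpha> \<beta>. \<forall>k\<in>{0..n}. X k = \<alpha> + \<beta> * real k}"

text \<open>
  Geometrically, the Kaehler functions on \<open>S\<^sup>2\<close> are those whose Hamiltonian vector field is Killing;
  these are exactly the linear combinations of \<open>1, x, y, z\<close>.
\<close>

definition kaehler_function :: "(real^3 \<Rightarrow> real) \<Rightarrow> bool"
  where "kaehler_function f \<longleftrightarrow>
    (\<exists>c0 c1 c2 c3. \<forall>s\<in>sphere 0 1. f s = c0 + c1 * s $ 1 + c2 * s $ 2 + c3 * s $ 3)"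

text \<open>The rotation \<open>\<phi> \<in> SO(3)\<close> is given by its matrix.\<close>

definition decomposition :: "nat \<Rightarrow> (real^3 \<Rightarrow> real) \<Rightarrow> (nat \<Rightarrow> real) \<Rightarrow> real^3^3 \<Rightarrow> bool"
  where "decomposition n f X \<phi> \<longleftrightarrow> X \<in> affine_rvs n \<and> rotation_matrix \<phi> \<and>
    (\<forall>s\<in>sphere 0 1. f s = (\<Sum>k=0..n. X k * binomial_prob n (\<phi> *v s) k))"

text \<open>
  For a Kaehler function \<open>f\<close> and \<open>n \<ge> 1\<close> the following definite descriptions are well-defined: see
  \<open>decomposition_exists\<close>, \<open>spec_eq\<close> and \<open>spec_prob_eq\<close> below.
\<close>

definition spec :: "nat \<Rightarrow> (real^3 \<Rightarrow> real) \<Rightarrow> real set"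
  where "spec n f = (THE S. \<exists>X \<phi>. decomposition n f X \<phi> \<and> S = X ` {0..n})"

definition spec_prob :: "nat \<Rightarrow> (real^3 \<Rightarrow> real) \<Rightarrow> real^3 \<Rightarrow> real set \<Rightarrow> real"
  where "spec_prob n f s A = (THE p. \<exists>X \<phi>. decomposition n f X \<phi> \<and>
    p = (\<Sum>k\<in>{k\<in>{0..n}. X k \<in> A}. binomial_prob n (\<phi> *v s) k))"

lemma binomial_prob_Bernstein:
  assumes "k \<le> n"
  shows "binomial_prob n s k = Bernstein n k ((1 + s $ 1) / 2)"
proof -
  have "1 - (1 + s $ 1) / 2 = (1 - s $ 1) / 2" by (simp add: field_simps)
  moreover have "(2::real) ^ n = 2 ^ k * 2 ^ (n - k)"
    using assms by (simp flip: power_add)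
  ultimately show ?thesis
    by (simp only: binomial_prob_def Bernstein_def power_divide) simp
qed

lemma sum_binomial_prob: "(\<Sum>k=0..n. binomial_prob n s k) = 1"
  using sum_Bernstein[of n "(1 + s $ 1) / 2"]
  by (simp add: binomial_prob_Bernstein atLeast0AtMost)

lemma sum_affine_binomial_prob:
  assumes "\<forall>k\<in>{0..n}. X k = \<alpha> + \<beta> * real k"
  shows "(\<Sum>k=0..n. X k * binomial_prob n s k) = \<alpha> + \<beta> * real n / 2 + \<beta> * real n / 2 * s $ 1"
proof -
  let ?x = "(1 + s $ 1) / 2"
  have "(\<Sum>k=0..n. X k * binomial_prob n s k) =
      (\<Sum>k\<le>n. \<alpha> * Bernstein n k ?x + \<beta> * (real k * Bernstein n k ?x))"
    using assms by (intro sum.cong) (auto simp: binomial_prob_Bernstein algebra_simps)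
  also have "\<dots> = \<alpha> + \<beta> * (real n * ?x)"
    by (simp only: sum.distrib flip: sum_distrib_left) (simp add: sum_k_Bernstein)
  finally show ?thesis by (simp add: field_simps)
qed

lemma matrix_vector_component: "((A::real^3^3) *v s) $ i = A $ i \<bullet> s"
  by (simp add: matrix_vector_mult_def inner_vec_def)

lemma norm_row_rotation:
  assumes "rotation_matrix (\<phi>::real^3^3)"
  shows "norm (\<phi> $ i) = 1"
  using assms by (metis rotation_matrix_def orthogonal_matrix_orthonormal_rows row_def vec_nth_inverse)

theorem decomposition_exists:
  assumes "n \<ge> 1" "kaehler_function f"
  obtains X \<phi> where "decomposition n f X \<phi>"
proof -
  obtain c0 c1 c2 c3 where f: "\<And>s. s \<in> sphere 0 1 \<Longrightarrow> f s = c0 + c1 * s $ 1 + c2 * s $ 2 + c3 * s $ 3"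
    using assms(2) unfolding kaehler_function_def by blast
  define c :: "real^3" where "c = vector [c1, c2, c3]"
  have f': "f s = c0 + c \<bullet> s" if "s \<in> sphere 0 1" for s
    using f[OF that] by (simp add: c_def inner_vec_def sum_3)
  obtain \<phi> :: "real^3^3" where \<phi>: "rotation_matrix \<phi>" "norm c *\<^sub>R \<phi> $ 1 = c"
  proof (cases "c = 0")
    case True
    have "rotation_matrix (mat 1 :: real^3^3)"
      by (simp add: rotation_matrix_def orthogonal_matrix_id)
    then show thesis using that True by simp
  next
    case False
    then obtain A :: "real^3^3" where A: "rotation_matrix A" "A *v axis 1 1 = c /\<^sub>R norm c"
      using rotation_matrix_exists_basis[of "c /\<^sub>R norm c" 1] by auto
    have "transpose A $ 1 = A *v axis 1 1"
      by (simp add: vec_eq_iff transpose_def matrix_vector_mult_basis column_def)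
    moreover have "rotation_matrix (transpose A)"
      using A(1) by (simp add: rotation_matrix_def orthogonal_matrix_transpose det_transpose)
    ultimately show thesis using that[of "transpose A"] A(2) False by simp
  qed
  define X where "X k = (c0 - norm c) + 2 * norm c / n * real k" for k :: nat
  have "f s = (\<Sum>k=0..n. X k * binomial_prob n (\<phi> *v s) k)" if "s \<in> sphere 0 1" for s
  proof -
    have "c \<bullet> s = norm c * (\<phi> $ 1 \<bullet> s)"
      by (subst \<phi>(2)[symmetric]) (simp only: inner_scaleR_left)
    then show ?thesis
      using assms(1) f'[OF that] sum_affine_binomial_prob[of n X "c0 - norm c" "2 * norm c / n" "\<phi> *v s"]
      by (simp add: X_def matrix_vector_component)
  qed
  moreover have "X \<in> affine_rvs n"
    unfolding affine_rvs_def X_def by blast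
  ultimately have "decomposition n f X \<phi>"
    using \<phi>(1) unfolding decomposition_def by blast
  then show thesis by (rule that)
qed

lemma decomposition_unique:
  assumes n: "n \<ge> 1" and "decomposition n f X \<phi>" "decomposition n f Y \<psi>"
  shows "X ` {0..n} = Y ` {0..n}"
    and "(\<Sum>k\<in>{k\<in>{0..n}. X k \<in> A}. binomial_prob n (\<phi> *v s) k) =
      (\<Sum>k\<in>{k\<in>{0..n}. Y k \<in> A}. binomial_prob n (\<psi> *v s) k)"
proof -
  obtain \<alpha> \<beta> where X: "\<forall>k\<in>{0..n}. X k = \<alpha> + \<beta> * real k"
    using assms by (auto simp: decomposition_def affine_rvs_def)
  obtain \<alpha>' \<beta>' where Y: "\<forall>k\<in>{0..n}. Y k = \<alpha>' + \<beta>' * real k"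
    using assms by (auto simp: decomposition_def affine_rvs_def)
  have unit: "norm (\<phi> $ 1) = 1" "norm (\<psi> $ 1) = 1"
    using assms by (auto simp: decomposition_def norm_row_rotation)
  have eq: "\<alpha> + \<beta> * real n / 2 + \<beta> * real n / 2 * (\<phi> $ 1 \<bullet> t) =
      \<alpha>' + \<beta>' * real n / 2 + \<beta>' * real n / 2 * (\<psi> $ 1 \<bullet> t)" if "norm t = 1" for t
    using assms that sum_affine_binomial_prob[OF X, of "\<phi> *v t"] sum_affine_binomial_prob[OF Y, of "\<psi> *v t"]
    by (simp add: decomposition_def matrix_vector_component)
  have comp: "\<beta> * \<phi> $ 1 $ i = \<beta>' * \<psi> $ 1 $ i \<and> \<alpha> + \<beta> * real n / 2 = \<alpha>' + \<beta>' * real n / 2" for i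
  proof -
    have "\<alpha> + \<beta> * real n / 2 + \<beta> * real n / 2 * \<phi> $ 1 $ i =
        \<alpha>' + \<beta>' * real n / 2 + \<beta>' * real n / 2 * \<psi> $ 1 $ i"
      using eq[of "axis i 1"] by (simp add: inner_axis)
    moreover have "\<alpha> + \<beta> * real n / 2 - \<beta> * real n / 2 * \<phi> $ 1 $ i =
        \<alpha>' + \<beta>' * real n / 2 - \<beta>' * real n / 2 * \<psi> $ 1 $ i"
      using eq[of "- axis i 1"] by (simp add: inner_axis)
    ultimately have "\<beta> * real n / 2 * \<phi> $ 1 $ i = \<beta>' * real n / 2 * \<psi> $ 1 $ i \<and>
        \<alpha> + \<beta> * real n / 2 = \<alpha>' + \<beta>' * real n / 2"
      by linarith
    then show ?thesis using n by simp
  qed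
  then have vec: "\<beta> *\<^sub>R \<phi> $ 1 = \<beta>' *\<^sub>R \<psi> $ 1" and const: "\<alpha> + \<beta> * real n / 2 = \<alpha>' + \<beta>' * real n / 2"
    by (auto simp: vec_eq_iff)
  from vec unit have abs: "\<bar>\<beta>\<bar> = \<bar>\<beta>'\<bar>" by (metis norm_scaleR mult.right_neutral)
  have "X ` {0..n} = Y ` {0..n} \<and> (\<Sum>k\<in>{k\<in>{0..n}. X k \<in> A}. binomial_prob n (\<phi> *v s) k) =
      (\<Sum>k\<in>{k\<in>{0..n}. Y k \<in> A}. binomial_prob n (\<psi> *v s) k)"
  proof -
    consider "\<beta> = 0" "\<beta>' = 0" | "\<beta> \<noteq> 0" "\<beta>' = \<beta>" | "\<beta> \<noteq> 0" "\<beta>' = - \<beta>"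
      using abs by linarith
    then show ?thesis
    proof cases
      case 1
      then have "X k = \<alpha>" "Y k = \<alpha>" if "k \<in> {0..n}" for k using X Y const that by auto
      then have "X ` {0..n} = Y ` {0..n}" "{k\<in>{0..n}. X k \<in> A} = (if \<alpha> \<in> A then {0..n} else {})"
        "{k\<in>{0..n}. Y k \<in> A} = (if \<alpha> \<in> A then {0..n} else {})" by auto
      then show ?thesis by (simp only: sum_binomial_prob split: if_split) simp
    next
      case 2
      then have XY: "X k = Y k" if "k \<in> {0..n}" for k using X Y const that by auto
      have "\<phi> $ 1 = \<psi> $ 1" using vec 2 by simp
      then have "binomial_prob n (\<phi> *v s) k = binomial_prob n (\<psi> *v s) k" for k
        by (simp add: binomial_prob_def matrix_vector_component)
      moreover have "X ` {0..n} = Y ` {0..n}" "{k\<in>{0..n}. X k \<in> A} = {k\<in>{0..n}. Y k \<in> A}"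
        using XY by auto
      ultimately show ?thesis by simp
    next
      case 3
      have "\<alpha>' = \<alpha> + \<beta> * real n" using const 3 by (simp add: field_simps)
      then have XY: "Y (n - k) = X k" if "k \<le> n" for k
        using bspec[OF X, of k] bspec[OF Y, of "n - k"] 3 that by (simp add: algebra_simps)
      have "\<beta> *\<^sub>R (\<phi> $ 1) = \<beta> *\<^sub>R (- (\<psi> $ 1))" using vec 3 by simp
      then have "\<phi> $ 1 = - (\<psi> $ 1)" using 3 by (simp only: scaleR_cancel_left) simp
      then have P: "binomial_prob n (\<psi> *v s) (n - k) = binomial_prob n (\<phi> *v s) k" if "k \<le> n" for k
        using that by (simp add: binomial_prob_def matrix_vector_component binomial_symmetric[OF that] mult_ac)
      have "X ` {0..n} = Y ` {0..n}"
      proof safe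
        fix k assume "k \<in> {0..n}"
        then show "X k \<in> Y ` {0..n}" using XY[of k] by (intro image_eqI[of _ _ "n - k"]) auto
      next
        fix k assume "k \<in> {0..n}"
        then show "Y k \<in> X ` {0..n}" using XY[of "n - k"] by (intro image_eqI[of _ _ "n - k"]) auto
      qed
      moreover have "(\<Sum>k\<in>{k\<in>{0..n}. X k \<in> A}. binomial_prob n (\<phi> *v s) k) =
          (\<Sum>k\<in>{k\<in>{0..n}. Y k \<in> A}. binomial_prob n (\<psi> *v s) k)"
      proof (rule sum.reindex_bij_witness[where i = "\<lambda>k. n - k" and j = "\<lambda>k. n - k"])
        fix k assume "k \<in> {k\<in>{0..n}. Y k \<in> A}"
        then show "n - k \<in> {k\<in>{0..n}. X k \<in> A}" using XY[of "n - k"] by auto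
      qed (auto simp: XY P)
      ultimately show ?thesis by blast
    qed
  qed
  then show "X ` {0..n} = Y ` {0..n}"
    and "(\<Sum>k\<in>{k\<in>{0..n}. X k \<in> A}. binomial_prob n (\<phi> *v s) k) =
      (\<Sum>k\<in>{k\<in>{0..n}. Y k \<in> A}. binomial_prob n (\<psi> *v s) k)" by blast+
qed

theorem spec_eq:
  assumes "n \<ge> 1" "decomposition n f X \<phi>"
  shows "spec n f = X ` {0..n}"
  unfolding spec_def
  by (rule the_equality) (use assms decomposition_unique(1)[OF assms(1)] in blast)+

theorem spec_prob_eq:
  assumes "n \<ge> 1" "decomposition n f X \<phi>"
  shows "spec_prob n f s A = (\<Sum>k\<in>{k\<in>{0..n}. X k \<in> A}. binomial_prob n (\<phi> *v s) k)"
  unfolding spec_prob_def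
  by (rule the_equality) (use assms decomposition_unique(2)[OF assms(1)] in blast)+

end

theory Submission
  imports Defs
begin

text \<open>
  Under \<open>binomial_prob n s\<close> the expectation of \<open>\<alpha> + \<beta> k\<close> is an affine function of the first coordinate
  of \<open>s\<close> alone: the mean is \<open>n (1 + s $ 1) / 2\<close>, so \<open>k - n / 2\<close> has expectation \<open>n / 2\<close> times
  \<open>s $ 1\<close>. A rotation \<open>\<phi>\<close> whose first row is \<open>c = (u, v, w)\<close> normalised turns that coordinate into
  \<open>c \<bullet> s / \<parallel>c\<parallel>\<close>. Precisely because \<open>\<parallel>c\<parallel> = n / 2\<close>, the random variable \<open>k - n / 2\<close>, of slope 1,
  therefore decomposes \<open>f\<close>.

  Neither the spectrum nor the spectral probabilities depend on the decomposition (\<open>spec_eq\<close>,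
  \<open>spec_prob_eq\<close>), so this one computes both the spectrum, as the image of \<open>k - n / 2\<close>, and the
  probabilities. As \<open>k - n / 2\<close> is injective, the probability of an eigenvalue is a single binomial
  weight at \<open>cos \<theta> = c \<bullet> s / \<parallel>c\<parallel>\<close>, and the half-angle formulas turn \<open>(1 \<plusminus> cos \<theta>) / 2\<close> into
  \<open>cos\<^sup>2 (\<theta> / 2)\<close> and \<open>sin\<^sup>2 (\<theta> / 2)\<close>.
\<close>

text \<open>
  Rotations act transitively on the sphere, so some rotation has \<open>a\<close> as the image of the first basis
  vector, that is, as its first column; the transpose is again a rotation.
\<close>

lemma rotation_matrix_with_first_row:
  fixes a :: "real^3"
  assumes "norm a = 1"
  obtains \<phi> :: "real^3^3" where "rotation_matrix \<phi>" "\<phi> $ 1 = a"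
proof -
  obtain A :: "real^3^3" where A: "rotation_matrix A" "A *v axis 1 1 = a"
    using rotation_matrix_exists_basis[of a 1] assms by auto
  have "transpose A $ 1 = a"
    using A(2) by (simp add: vec_eq_iff transpose_def matrix_vector_mult_basis column_def)
  moreover have "rotation_matrix (transpose A)"
    using A(1) by (simp add: rotation_matrix_def orthogonal_matrix_transpose det_transpose)
  ultimately show thesis by (rule that[rotated])
qed

text \<open>
  The coefficient of \<open>\<phi> $ 1 \<bullet> s\<close> in the expectation of \<open>\<beta> k\<close> is \<open>\<beta> n / 2\<close>, so the norm condition
  on \<open>c\<close> is exactly what makes the eigenvalues spaced by \<open>\<beta> = 1\<close>. Subtracting \<open>n / 2\<close> centres them,
  since \<open>f\<close> has no constant term.
\<close>

lemma decomposition_of_spin_function: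
  fixes c :: "real^3"
  assumes c: "norm c = real n / 2"
    and f: "\<And>s. s \<in> sphere 0 1 \<Longrightarrow> f s = c \<bullet> s"
    and \<phi>: "rotation_matrix \<phi>" "norm c *\<^sub>R \<phi> $ 1 = c"
  shows "decomposition n f (\<lambda>k. - (real n / 2) + real k) \<phi>"
proof -
  have "f s = (\<Sum>k=0..n. (- (real n / 2) + real k) * binomial_prob n (\<phi> *v s) k)"
    if "s \<in> sphere 0 1" for s
  proof -
    have "c \<bullet> s = norm c * (\<phi> $ 1 \<bullet> s)"
      by (subst \<phi>(2)[symmetric]) (simp only: inner_scaleR_left)
    then show ?thesis
      using f[OF that] c
        sum_affine_binomial_prob[of n "\<lambda>k. - (real n / 2) + real k" "- (real n / 2)" 1 "\<phi> *v s"]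
      by (simp add: matrix_vector_component)
  qed
  moreover have "(\<lambda>k. - (real n / 2) + real k) \<in> affine_rvs n"
    unfolding affine_rvs_def
    by (intro CollectI exI[where x = "- (real n / 2)"] exI[where x = 1] ballI) simp
  ultimately show ?thesis
    using \<phi>(1) unfolding decomposition_def by blast
qed

lemma binomial_prob_half_angle:
  assumes "k \<le> n" "s $ 1 = cos \<theta>"
  shows "binomial_prob n s k =
    real (n choose k) * ((cos (\<theta> / 2))\<^sup>2) ^ k * ((sin (\<theta> / 2))\<^sup>2) ^ (n - k)"
proof -
  have "(1 + cos \<theta>) / 2 = (cos (\<theta> / 2))\<^sup>2"
    using cos_double_cos[of "\<theta> / 2"] by simp
  moreover have "1 - (cos (\<theta> / 2))\<^sup>2 = (sin (\<theta> / 2))\<^sup>2"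
    by (simp add: sin_squared_eq)
  ultimately show ?thesis
    using assms by (simp add: binomial_prob_Bernstein Bernstein_def)
qed

theorem corollary9p4:
  fixes n :: nat and u v w j :: real and f :: "real^3 \<Rightarrow> real"
  assumes "n \<ge> 1"
    and "j = real n / 2"
    and "norm (vector [u, v, w] :: real^3) = j"
    and "\<And>x y z. vector [x, y, z] \<in> (sphere 0 1 :: (real^3) set) \<Longrightarrow>
           f (vector [x, y, z]) = u * x + v * y + w * z"
  shows "spec n f = {- j + real k | k. k \<in> {0..n}} \<and>
    (\<forall>x y z. vector [x, y, z] \<in> (sphere 0 1 :: (real^3) set) \<longrightarrow>
      (\<forall>k\<in>{0..n}. \<forall>\<theta>.
        (u * x + v * y + w * z) / norm (vector [u, v, w] :: real^3) = cos \<theta> \<longrightarrow>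
        spec_prob n f (vector [x, y, z]) {- j + real k} =
          real (n choose k) * ((cos (\<theta> / 2))\<^sup>2) ^ k * ((sin (\<theta> / 2))\<^sup>2) ^ (n - k)))"
proof -
  define c :: "real^3" where "c = vector [u, v, w]"
  have c: "norm c = j" "norm c > 0"
    using assms(1-3) by (auto simp: c_def)
  have inner_c: "c \<bullet> vector [x, y, z] = u * x + v * y + w * z" for x y z
    by (simp add: c_def inner_vec_def sum_3)
  have f: "f s = c \<bullet> s" if "s \<in> sphere 0 1" for s
  proof -
    have "s = vector [s $ 1, s $ 2, s $ 3]"
      by (simp add: vec_eq_iff forall_3)
    then show ?thesis
      using assms(4)[of "s $ 1" "s $ 2" "s $ 3"] inner_c[of "s $ 1" "s $ 2" "s $ 3"] that by simp
  qed
  obtain \<phi> :: "real^3^3" where \<phi>: "rotation_matrix \<phi>" "\<phi> $ 1 = c /\<^sub>R norm c"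
    using rotation_matrix_with_first_row[of "c /\<^sub>R norm c"] c(2) by auto
  have "norm c *\<^sub>R \<phi> $ 1 = c"
    using \<phi>(2) c(2) by simp
  then have dec: "decomposition n f (\<lambda>k. - j + real k) \<phi>"
    using decomposition_of_spin_function[of c n f \<phi>] c(1) f \<phi>(1) unfolding assms(2) by blast
  have "spec n f = {- j + real k | k. k \<in> {0..n}}"
    using spec_eq[OF assms(1) dec] by auto
  moreover have "spec_prob n f (vector [x, y, z]) {- j + real k} =
      real (n choose k) * ((cos (\<theta> / 2))\<^sup>2) ^ k * ((sin (\<theta> / 2))\<^sup>2) ^ (n - k)"
    if k: "k \<in> {0..n}" and \<theta>: "(u * x + v * y + w * z) / norm (vector [u, v, w] :: real^3) = cos \<theta>"
    for x y z k \<theta>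
  proof -
    have "{i \<in> {0..n}. - j + real i \<in> {- j + real k}} = {k}"
      using k by auto
    then have "spec_prob n f (vector [x, y, z]) {- j + real k} = binomial_prob n (\<phi> *v vector [x, y, z]) k"
      using spec_prob_eq[OF assms(1) dec] by simp
    moreover have "(\<phi> *v vector [x, y, z]) $ 1 = cos \<theta>"
      using \<theta> by (simp add: matrix_vector_component \<phi>(2) inner_c divide_inverse_commute flip: c_def)
    ultimately show ?thesis
      using binomial_prob_half_angle k by simp
  qed
  ultimately show ?thesis by blast
qed

end
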